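(* Let $0<p\le1$ be a constant and $0<\varepsilon<(p/4)^{16}$. There is a constant $n_0$ such that for every natural number $n\ge n_0$, every graph $G\in\mathcal{Q}(n^{(2)},p,\varepsilon)$ admits a $10\varepsilon$-near quadrangular embedding.
   Context: Cut distance: for edge-weighted graphs $G,H$ on the same vertex set $V$, $\mathsf{d}_\square(G,H)=\max_{U,W\subseteq V}|\mathsf{e}_G(U,W)-\mathsf{e}_H(U,W)|/|V|^2$, with $\mathsf{e}_G(U,W)$ the total weight of edges with one endvertex in $U$ and the other in $W$. $K(n^{(2)},p)$ is the weighted complete bipartite graph on $V_1\sqcup V_2$, $|V_1|=|V_2|=n$, all edges between $V_1$ and $V_2$ having weight $p$. $\mathcal{Q}(n^{(2)},p,\varepsilon)$ is the set of graphs $G$ on vertex set $V_1\sqcup V_2$ (after a suitable identification) with $\mathsf{d}_\square(G,K(n^{(2)},p))<\varepsilon$. An embedding is a 2-cell embedding in an orientable surface (rotation system). For $\delta>0$ an embedding is $\delta$-near quadrangular if all but at most $2\delta|E(G)|$ edges of $G$ belong to two quadrangular faces (faces bounded by cycles of length 4). *)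

theory Defs
  imports Complex_Main "Graph_Theory.Pair_Digraph" "HOL-Combinatorics.Orbits"
begin

text \<open>
  Finite simple graphs are the symmetric loop-free digraphs of \<^locale>\<open>pair_graph\<close>; an edge
  is the set of its two ends, and the two arcs on it are its two orientations.
\<close>

definition uedges :: "'a pair_pre_digraph \<Rightarrow> 'a set set" where
  "uedges G = {{u, v} | u v. (u, v) \<in> parcs G}"

text \<open>
  An edge-weighted graph on a vertex set is a weight function on unordered pairs of distinct
  vertices, non-edges having weight 0. In \<open>cut_weight\<close> each edge is counted once, also if it
  lies inside \<open>U \<inter> W\<close>.
\<close>

definition cut_weight :: "('a set \<Rightarrow> real) \<Rightarrow> 'a set \<Rightarrow> 'a set \<Rightarrow> real" where
  "cut_weight w U W = (\<Sum>e \<in> {{u, v} | u v. u \<in> U \<and> v \<in> W \<and> u \<noteq> v}. w e)"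

definition cut_dist :: "'a set \<Rightarrow> ('a set \<Rightarrow> real) \<Rightarrow> ('a set \<Rightarrow> real) \<Rightarrow> real" where
  "cut_dist V w w' =
     Max {\<bar>cut_weight w U W - cut_weight w' U W\<bar> | U W. U \<subseteq> V \<and> W \<subseteq> V} / (real (card V))\<^sup>2"

definition graph_weight :: "'a pair_pre_digraph \<Rightarrow> 'a set \<Rightarrow> real" where
  "graph_weight G e = (if e \<in> uedges G then 1 else 0)"

definition complete_bipartite_weight :: "'a set \<Rightarrow> 'a set \<Rightarrow> real \<Rightarrow> 'a set \<Rightarrow> real" where
  "complete_bipartite_weight V1 V2 p e = (if \<exists>u\<in>V1. \<exists>v\<in>V2. e = {u, v} then p else 0)"

text \<open>The identification of the vertex set with that of the complete bipartite graph is the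
  choice of \<open>V1\<close> and \<open>V2\<close>. The graph itself need not be bipartite.\<close>

definition quasirandom_bipartite :: "nat \<Rightarrow> real \<Rightarrow> real \<Rightarrow> 'a pair_pre_digraph set" where
  "quasirandom_bipartite n p \<epsilon> =
     {G. pair_graph G \<and>
         (\<exists>V1 V2. V1 \<inter> V2 = {} \<and> V1 \<union> V2 = pverts G \<and> card V1 = n \<and> card V2 = n \<and>
            cut_dist (pverts G) (graph_weight G) (complete_bipartite_weight V1 V2 p) < \<epsilon>)}"

definition neighbours :: "'a pair_pre_digraph \<Rightarrow> 'a \<Rightarrow> 'a set" where
  "neighbours G v = {u. (v, u) \<in> parcs G}"

text \<open>
  A 2-cell embedding in an orientable surface is given by its rotation system: \<open>rot v\<close> is a
  cyclic permutation of the neighbours of \<open>v\<close>. If the graph is disconnected, this describes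
  a 2-cell embedding of each component in its own surface. Values of \<open>rot v\<close> outside
  the neighbours of \<open>v\<close> are irrelevant.
\<close>

definition rotation_system :: "'a pair_pre_digraph \<Rightarrow> ('a \<Rightarrow> 'a \<Rightarrow> 'a) \<Rightarrow> bool" where
  "rotation_system G rot \<longleftrightarrow>
     (\<forall>v \<in> pverts G. neighbours G v \<noteq> {} \<longrightarrow> cyclic_on (rot v) (neighbours G v))"

text \<open>Face tracing: a face is the set of arcs on its boundary walk, so each arc lies on exactly
  one face and each edge is traversed twice in total.\<close>

definition face_succ :: "('a \<Rightarrow> 'a \<Rightarrow> 'a) \<Rightarrow> 'a \<times> 'a \<Rightarrow> 'a \<times> 'a" where
  "face_succ rot a = (snd a, rot (snd a) (fst a))"

definition faces :: "'a pair_pre_digraph \<Rightarrow> ('a \<Rightarrow> 'a \<Rightarrow> 'a) \<Rightarrow> ('a \<times> 'a) set set" where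
  "faces G rot = orbit (face_succ rot) ` parcs G"

text \<open>Distinctness of the vertices excludes closed walks of length 4 that are not cycles.\<close>

definition quadrangular :: "('a \<times> 'a) set \<Rightarrow> bool" where
  "quadrangular F \<longleftrightarrow>
     (\<exists>a b c d. distinct [a, b, c, d] \<and> F = {(a, b), (b, c), (c, d), (d, a)})"

definition on_face :: "'a set \<Rightarrow> ('a \<times> 'a) set \<Rightarrow> bool" where
  "on_face e F \<longleftrightarrow> (\<exists>u v. (u, v) \<in> F \<and> e = {u, v})"

definition near_quadrangular :: "real \<Rightarrow> 'a pair_pre_digraph \<Rightarrow> ('a \<Rightarrow> 'a \<Rightarrow> 'a) \<Rightarrow> bool" where
  "near_quadrangular \<delta> G rot \<longleftrightarrow>
     real (card {e \<in> uedges G. card {F \<in> faces G rot. quadrangular F \<and> on_face e F} \<noteq> 2})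
       \<le> 2 * \<delta> * real (card (uedges G))"

end

theory Submission
  imports Defs
begin

text \<open>
  Only the edge density of \<open>G\<close> matters. By the Kovari-Sos-Turan argument a dense graph contains
  a copy of \<open>K\<^sub>t\<^sub>,\<^sub>t\<close> for a large even constant \<open>t\<close>, so copies can be removed greedily until few
  edges are left. Each copy has a quadrangular embedding. Putting it back into an embedding of the
  rest means splicing two cyclic rotations at each of its \<open>2t\<close> vertices; each splice changes two
  corners and so spoils at most two quadrangles, which costs \<open>16t\<close> of the \<open>2t\<^sup>2\<close> arcs of the copy.
\<close>

section \<open>Cyclic permutations: splicing and alternating cycles\<close>

text \<open>Exchanging the successors of \<open>x\<close> and \<open>y\<close> joins the two cycles:
  from \<open>y\<close>, the map \<open>h\<close> enters \<open>S\<close> at \<open>f x\<close>,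
  runs round to \<open>x\<close>, jumps to \<open>g y\<close> and runs through \<open>T\<close> back
  to \<open>y\<close>.\<close>

lemma cyclic_on_splice:
  assumes "cyclic_on f S" "cyclic_on g T" "x \<in> S" "y \<in> T"
    and "h x = g y" "h y = f x"
    and hS: "\<And>z. z \<in> S \<Longrightarrow> z \<noteq> x \<Longrightarrow> h z = f z"
    and hT: "\<And>z. z \<in> T \<Longrightarrow> z \<noteq> y \<Longrightarrow> h z = g z"
  shows "cyclic_on h (S \<union> T)"
proof -
  have S: "S = orbit f x" and T: "T = orbit g y"
    using assms by (auto simp: cyclic_on_alldef)
  have 1: "z \<in> orbit h y" if "z \<in> orbit f x" for z
    using that
  proof induction
    case base
    then show ?case using assms(6) orbit.base[of h y] by simp
  next
    case (step z)
    then show ?case using assms(6) hS[of z] S orbit.base[of h y] orbit.step[of z h y]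
      by (cases "z = x") auto
  qed
  have 2: "z \<in> orbit h x" if "z \<in> orbit g y" for z
    using that
  proof induction
    case base
    then show ?case using assms(5) orbit.base[of h x] by simp
  next
    case (step z)
    then show ?case using assms(5) hT[of z] T orbit.base[of h x] orbit.step[of z h x]
      by (cases "z = y") auto
  qed
  have closed: "h z \<in> S \<union> T" if "z \<in> S \<union> T" for z
    using that assms(5,6) hS[of z] hT[of z] S T orbit.base[of f x] orbit.base[of g y]
      orbit.step[of z f x] orbit.step[of z g y] by (metis Un_iff)
  have 3: "z \<in> S \<union> T" if "z \<in> orbit h y" for z
    using that by induction (use closed \<open>y \<in> T\<close> in auto)
  have "x \<in> orbit h y" using 1 S \<open>x \<in> S\<close> by simp
  then have "S \<union> T \<subseteq> orbit h y"
    using 1 2 S T by (auto intro: orbit_trans)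
  then have "S \<union> T = orbit h y" using 3 by auto
  then show ?thesis using \<open>y \<in> T\<close> unfolding cyclic_on_def by blast
qed

lemma cyclic_on_id_singleton: "cyclic_on id {x}"
proof -
  have "z = x" if "z \<in> orbit id x" for z using that by induction auto
  then have "orbit id x = {x}" using orbit.base[of id x] by auto
  then show ?thesis unfolding cyclic_on_def by auto
qed

lemma ex_cyclic_on:
  assumes "finite S" "S \<noteq> {}"
  shows "\<exists>f. cyclic_on f S"
  using assms
proof (induction rule: finite_ne_induct)
  case (singleton x)
  show ?case by (rule exI[of _ id]) (rule cyclic_on_id_singleton)
next
  case (insert x F)
  then obtain f where f: "cyclic_on f F" by blast
  obtain y where y: "y \<in> F" using insert by auto
  have "cyclic_on (f(x := f y, y := x)) ({x} \<union> F)"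
    by (rule cyclic_on_splice[OF cyclic_on_id_singleton[of x] f, of x y]) (use y insert in auto)
  then show ?case by auto
qed

text \<open>Supplies a cyclic order for one side of a complete bipartite graph, together with its
  reversal \<open>f'\<close>. It is the successor modulo \<open>t\<close> transported to
  \<open>S\<close>; the parity of the index flips at the wrap-around too because \<open>t\<close> is
  even.\<close>

lemma ex_alternating_cycle:
  assumes "even (card S)" "card S > 0"
  shows "\<exists>f f' par. cyclic_on f S \<and> cyclic_on f' S \<and>
           (\<forall>x\<in>S. f x \<in> S \<and> f' x \<in> S \<and> f' (f x) = x \<and> f (f' x) = x \<and>
              par (f x) = (\<not> par x) \<and> par (f' x) = (\<not> par x))"
proof -
  define t where "t = card S"
  have t: "even t" "t > 0" "finite S" using assms by (auto simp: t_def card_gt_0_iff)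
  then have t2: "t \<ge> 2" by (metis dvd_imp_le)
  obtain h where h: "bij_betw h {..<t} S"
    using ex_bij_betw_nat_finite[OF t(3)] by (auto simp: t_def atLeast0LessThan)
  define k where "k = inv_into {..<t} h"
  have kh: "k (h i) = i" if "i < t" for i
    using h that by (simp add: k_def bij_betw_inv_into_left)
  have hS: "h i \<in> S" if "i < t" for i using h that by (auto simp: bij_betw_def)
  have S: "\<exists>i<t. x = h i" if "x \<in> S" for x using h that by (auto simp: bij_betw_def)
  define up where "up i = (if i = t - 1 then 0 else i + 1)" for i
  define dn where "dn i = (if i = 0 then t - 1 else i - 1)" for i
  define f where "f x = h (up (k x))" for x
  define f' where "f' x = h (dn (k x))" for x
  have up: "up i < t" "dn i < t" "up (dn i) = i" "dn (up i) = i"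
    "even (up i) = odd i" "even (dn i) = odd i" if "i < t" for i
    using that t t2 by (auto simp: up_def dn_def)
  have props: "f x \<in> S \<and> f' x \<in> S \<and> f' (f x) = x \<and> f (f' x) = x \<and>
      even (k (f x)) = odd (k x) \<and> even (k (f' x)) = odd (k x)" if x: "x \<in> S" for x
    using S[OF x] by (auto simp: f_def f'_def kh up hS)
  have fh: "f (h i) = h (up i)" "f' (h i) = h (dn i)" if "i < t" for i
    using that by (auto simp: f_def f'_def kh)
  have sub: "orbit f x \<subseteq> S" if "x \<in> S" for x
  proof
    fix z assume "z \<in> orbit f x"
    then show "z \<in> S" by induction (use that props in auto)
  qed
  have sub': "orbit f' x \<subseteq> S" if "x \<in> S" for x
  proof
    fix z assume "z \<in> orbit f' x"
    then show "z \<in> S" by induction (use that props in auto)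
  qed
  \<comment> \<open>An \<open>orbit\<close> is generated from the first image, so the cycle is
    started at \<open>h (t - 1)\<close>, whose image is \<open>h 0\<close>; dually,
    \<open>f'\<close> is started at \<open>h 0\<close>.\<close>
  have o1: "h i \<in> orbit f (h (t - 1))" if "i < t" for i
    using that
  proof (induction i)
    case 0
    show ?case using fh(1)[of "t - 1"] t orbit.base[of f "h (t - 1)"] by (simp add: up_def)
  next
    case (Suc i)
    then have "up i = Suc i" by (auto simp: up_def)
    then show ?case using Suc fh(1)[of i] orbit.step[of "h i" f "h (t - 1)"] by auto
  qed
  have o2: "h (t - 1 - i) \<in> orbit f' (h 0)" if "i < t" for i
    using that
  proof (induction i)
    case 0
    show ?case using fh(2)[of 0] t orbit.base[of f' "h 0"] by (simp add: dn_def)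
  next
    case (Suc i)
    then show ?case using fh(2)[of "t - 1 - i"] orbit.step[of "h (t - 1 - i)" f' "h 0"]
      by (auto simp: dn_def)
  qed
  have h0: "h (t - 1) \<in> S" "h 0 \<in> S" using hS t by auto
  have "S = orbit f (h (t - 1))" using o1 S sub[OF h0(1)] by blast
  then have c1: "cyclic_on f S" using h0(1) unfolding cyclic_on_def by blast
  have "h i \<in> orbit f' (h 0)" if "i < t" for i
    using o2[of "t - 1 - i"] that by simp
  then have "S = orbit f' (h 0)" using S sub'[OF h0(2)] by blast
  then have c2: "cyclic_on f' S" using h0(2) unfolding cyclic_on_def by blast
  show ?thesis
    by (rule exI[of _ f], rule exI[of _ f'], rule exI[of _ "\<lambda>x. even (k x)"],
        intro conjI c1 c2 ballI) (simp_all add: props)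
qed

section \<open>Rotations of arc sets and the arcs off quadrangles\<close>

text \<open>Stated for a bare set of arcs, so that a graph can be split into arc-disjoint pieces and
  reassembled.\<close>

definition rotation_on :: "('a \<times> 'a) set \<Rightarrow> ('a \<Rightarrow> 'a \<Rightarrow> 'a) \<Rightarrow> bool" where
  "rotation_on E rot \<longleftrightarrow> (\<forall>v. E `` {v} \<noteq> {} \<longrightarrow> cyclic_on (rot v) (E `` {v}))"

text \<open>The four corners of a quadrangle, expressed by values of \<open>rot\<close> alone. As
  the arc set does not occur, the bad arcs of a union are the union of the bad arcs, and a change of
  rotation is felt only at these corners.\<close>

definition on_quad :: "('a \<Rightarrow> 'a \<Rightarrow> 'a) \<Rightarrow> 'a \<times> 'a \<Rightarrow> bool" where
  "on_quad rot e \<longleftrightarrow>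
     (\<exists>a b c d. e = (a, b) \<and> distinct [a, b, c, d] \<and>
        rot b a = c \<and> rot c b = d \<and> rot d c = a \<and> rot a d = b)"

definition bad_arcs :: "('a \<times> 'a) set \<Rightarrow> ('a \<Rightarrow> 'a \<Rightarrow> 'a) \<Rightarrow> ('a \<times> 'a) set" where
  "bad_arcs E rot = {e \<in> E. \<not> on_quad rot e}"

lemma on_quadI:
  assumes "distinct [a, b, c, d]" "rot b a = c" "rot c b = d" "rot d c = a" "rot a d = b"
  shows "on_quad rot (a, b)"
  using assms unfolding on_quad_def by blast

lemma rotation_on_closed:
  assumes "rotation_on E rot" "sym E" "(u, v) \<in> E"
  shows "(v, rot v u) \<in> E"
proof -
  have "u \<in> E `` {v}" using assms by (auto dest: symD)
  then have "cyclic_on (rot v) (E `` {v})" using assms by (auto simp: rotation_on_def)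
  then have "E `` {v} = orbit (rot v) u" using \<open>u \<in> E `` {v}\<close> by (auto simp: cyclic_on_alldef)
  then show ?thesis using orbit.base[of "rot v" u] by blast
qed

lemma ex_rotation_on:
  assumes "finite E"
  shows "\<exists>rot. rotation_on E rot"
proof -
  have "\<exists>f. E `` {v} \<noteq> {} \<longrightarrow> cyclic_on f (E `` {v})" for v
    using ex_cyclic_on[of "E `` {v}"] finite_Image[OF assms] by blast
  then show ?thesis unfolding rotation_on_def by metis
qed

text \<open>Changing a rotation at one arc destroys at most the face through that arc.\<close>

lemma card_bad_arcs_perturb:
  assumes rot: "rotation_on E rot" "sym E" "finite E" and "finite X"
    and h: "\<And>u v. (u, v) \<in> E \<Longrightarrow> (u, v) \<notin> X \<Longrightarrow> h v u = rot v u"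
  shows "card (bad_arcs E h) \<le> card (bad_arcs E rot) + 4 * card X"
proof -
  let ?s = "face_succ rot"
  \<comment> \<open>If a quadrangle passes through an arc of \<open>X\<close>, each of its four arcs
    is reached from that arc by at most three steps of face tracing; hence the factor 4.\<close>
  let ?Y = "X \<union> (?s ` X \<union> ((?s ^^ 2) ` X \<union> (?s ^^ 3) ` X))"
  have "bad_arcs E h \<subseteq> bad_arcs E rot \<union> ?Y"
  proof
    fix e assume e: "e \<in> bad_arcs E h"
    show "e \<in> bad_arcs E rot \<union> ?Y"
    proof (cases "on_quad rot e")
      case False
      then show ?thesis using e by (auto simp: bad_arcs_def)
    next
      case True
      then obtain a b c d where q: "e = (a, b)" "distinct [a, b, c, d]"
        "rot b a = c" "rot c b = d" "rot d c = a" "rot a d = b"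
        by (auto simp: on_quad_def)
      have E1: "(a, b) \<in> E" using e q by (auto simp: bad_arcs_def)
      have E2: "(b, c) \<in> E" using rotation_on_closed[OF rot(1,2) E1] q by simp
      have E3: "(c, d) \<in> E" using rotation_on_closed[OF rot(1,2) E2] q by simp
      have E4: "(d, a) \<in> E" using rotation_on_closed[OF rot(1,2) E3] q by simp
      \<comment> \<open>Otherwise all four corners keep their values under \<open>h\<close> and the
        quadrangle survives.\<close>
      have "(a, b) \<in> X \<or> (b, c) \<in> X \<or> (c, d) \<in> X \<or> (d, a) \<in> X"
      proof (rule ccontr)
        assume "\<not> ?thesis"
        then have "on_quad h e"
          unfolding on_quad_def using q E1 E2 E3 E4 h[of a b] h[of b c] h[of c d] h[of d a]
          by auto
        then show False using e by (auto simp: bad_arcs_def)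
      qed
      moreover have "e = ?s (d, a)" "e = (?s ^^ 2) (c, d)" "e = (?s ^^ 3) (b, c)"
        using q by (simp_all add: face_succ_def numeral_2_eq_2 numeral_3_eq_3)
      ultimately show ?thesis unfolding Un_iff using q(1) by (metis image_eqI)
    qed
  qed
  moreover have "finite (bad_arcs E rot \<union> ?Y)"
    using \<open>finite X\<close> \<open>finite E\<close> by (auto simp: bad_arcs_def)
  ultimately have "card (bad_arcs E h) \<le> card (bad_arcs E rot \<union> ?Y)" by (rule card_mono[rotated])
  also have "\<dots> \<le> card (bad_arcs E rot) + card ?Y" by (rule card_Un_le)
  also have "card ?Y \<le> card X + (card (?s ` X) + (card ((?s ^^ 2) ` X) + card ((?s ^^ 3) ` X)))"
    by (meson card_Un_le add_left_mono le_trans)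
  also have "\<dots> \<le> card X + (card X + (card X + card X))"
    by (intro add_mono card_image_le \<open>finite X\<close> order_refl)
  finally show ?thesis by simp
qed

lemma merge_rotations:
  assumes r1: "rotation_on E1 r1" "sym E1" "finite E1"
    and r2: "rotation_on E2 r2" "sym E2" "finite E2"
    and disj: "E1 \<inter> E2 = {}"
  shows "\<exists>rot. rotation_on (E1 \<union> E2) rot \<and>
    card (bad_arcs (E1 \<union> E2) rot) \<le>
      card (bad_arcs E1 r1) + card (bad_arcs E2 r2) + 8 * card (fst ` E2)"
proof -
  define M where "M = {v. E1 `` {v} \<noteq> {} \<and> E2 `` {v} \<noteq> {}}"
  have "M \<subseteq> fst ` E2" by (force simp: M_def)
  then have M: "finite M" "card M \<le> card (fst ` E2)"
    using r2(3) by (auto intro: finite_subset card_mono)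
  have "\<forall>v\<in>M. \<exists>x y. (v, x) \<in> E1 \<and> (v, y) \<in> E2" by (auto simp: M_def)
  then obtain x y where xy: "\<And>v. v \<in> M \<Longrightarrow> (v, x v) \<in> E1" "\<And>v. v \<in> M \<Longrightarrow> (v, y v) \<in> E2"
    by metis
  define h where "h v z = (if v \<in> M \<and> z = x v then r2 v (y v)
    else if v \<in> M \<and> z = y v then r1 v (x v)
    else if (v, z) \<in> E1 then r1 v z else r2 v z)" for v z
  \<comment> \<open>The value \<open>h v u\<close> governs the corner entered along the arc
    \<open>(u, v)\<close>, so the perturbed arcs of \<open>E1\<close> are those from
    \<open>x v\<close> into \<open>v\<close>, one for each shared vertex.\<close>
  have h1: "h v u = r1 v u" if "(u, v) \<in> E1" "(u, v) \<notin> (\<lambda>v. (x v, v)) ` M" for u v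
    using that symD[OF r1(2) that(1)] xy(2)[of v] disj by (auto simp: h_def)
  have h2: "h v u = r2 v u" if "(u, v) \<in> E2" "(u, v) \<notin> (\<lambda>v. (y v, v)) ` M" for u v
    using that symD[OF r2(2) that(1)] xy(1)[of v] disj by (auto simp: h_def)
  have rot: "cyclic_on (h v) ((E1 \<union> E2) `` {v})" if v: "(E1 \<union> E2) `` {v} \<noteq> {}" for v
  proof (cases "v \<in> M")
    case True
    have eq: "(E1 \<union> E2) `` {v} = E1 `` {v} \<union> E2 `` {v}" by auto
    have c: "cyclic_on (r1 v) (E1 `` {v})" "cyclic_on (r2 v) (E2 `` {v})"
      using True r1 r2 by (auto simp: M_def rotation_on_def)
    have ne: "x v \<noteq> y v" using xy[OF True] disj by auto
    show ?thesis unfolding eq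
      by (rule cyclic_on_splice[OF c, of "x v" "y v"])
        (use xy[OF True] ne True disj in \<open>auto simp: h_def\<close>)
  next
    case False
    then consider "E1 `` {v} \<noteq> {}" "E2 `` {v} = {}" | "E1 `` {v} = {}" "E2 `` {v} \<noteq> {}"
      using v by (auto simp: M_def)
    then show ?thesis
    proof cases
      case 1
      then have eq: "(E1 \<union> E2) `` {v} = E1 `` {v}" by auto
      have "cyclic_on (r1 v) (E1 `` {v})" using r1 1 by (auto simp: rotation_on_def)
      then show ?thesis unfolding eq
        by (subst cyclic_cong[of _ "h v" "r1 v"]) (use False in \<open>auto simp: h_def\<close>)
    next
      case 2
      then have eq: "(E1 \<union> E2) `` {v} = E2 `` {v}" by auto
      have "cyclic_on (r2 v) (E2 `` {v})" using r2 2 by (auto simp: rotation_on_def)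
      then show ?thesis unfolding eq
        by (subst cyclic_cong[of _ "h v" "r2 v"]) (use False disj in \<open>auto simp: h_def\<close>)
    qed
  qed
  have "card (bad_arcs (E1 \<union> E2) h) \<le> card (bad_arcs E1 h) + card (bad_arcs E2 h)"
  proof -
    have "bad_arcs (E1 \<union> E2) h = bad_arcs E1 h \<union> bad_arcs E2 h" by (auto simp: bad_arcs_def)
    then show ?thesis by (simp add: card_Un_le)
  qed
  also have "card (bad_arcs E1 h) \<le> card (bad_arcs E1 r1) + 4 * card ((\<lambda>v. (x v, v)) ` M)"
    by (rule card_bad_arcs_perturb[OF r1]) (use h1 M in auto)
  also have "card (bad_arcs E2 h) \<le> card (bad_arcs E2 r2) + 4 * card ((\<lambda>v. (y v, v)) ` M)"
    by (rule card_bad_arcs_perturb[OF r2]) (use h2 M in auto)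
  also have "card ((\<lambda>v. (x v, v)) ` M) \<le> card M" by (rule card_image_le[OF M(1)])
  also have "card ((\<lambda>v. (y v, v)) ` M) \<le> card M" by (rule card_image_le[OF M(1)])
  finally have "card (bad_arcs (E1 \<union> E2) h) \<le>
      card (bad_arcs E1 r1) + card (bad_arcs E2 r2) + 8 * card (fst ` E2)"
    using M(2) by simp
  then show ?thesis using rot unfolding rotation_on_def by blast
qed

text \<open>Going forward at the vertices of one parity and backward at those of the other makes every
  face a quadrangle.\<close>

lemma complete_bipartite_quadrangulation:
  assumes disj: "A \<inter> B = {}" and A: "even (card A)" "card A > 0" and B: "even (card B)" "card B > 0"
  shows "\<exists>rot. rotation_on (A \<times> B \<union> B \<times> A) rot \<and> bad_arcs (A \<times> B \<union> B \<times> A) rot = {}"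
proof -
  obtain f f' pA where f: "cyclic_on f A" "cyclic_on f' A"
    "\<forall>x\<in>A. f x \<in> A \<and> f' x \<in> A \<and> f' (f x) = x \<and> f (f' x) = x \<and>
       pA (f x) = (\<not> pA x) \<and> pA (f' x) = (\<not> pA x)"
    using ex_alternating_cycle[OF A] by auto
  obtain g g' pB where g: "cyclic_on g B" "cyclic_on g' B"
    "\<forall>x\<in>B. g x \<in> B \<and> g' x \<in> B \<and> g' (g x) = x \<and> g (g' x) = x \<and>
       pB (g x) = (\<not> pB x) \<and> pB (g' x) = (\<not> pB x)"
    using ex_alternating_cycle[OF B] by auto
  define rot where "rot v = (if v \<in> A then (if pA v then g else g') else (if pB v then f else f'))" for v
  have notA: "b \<notin> A" if "b \<in> B" for b using disj that by auto
  have "rotation_on (A \<times> B \<union> B \<times> A) rot"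
    unfolding rotation_on_def
  proof (intro allI impI)
    fix v assume ne: "(A \<times> B \<union> B \<times> A) `` {v} \<noteq> {}"
    show "cyclic_on (rot v) ((A \<times> B \<union> B \<times> A) `` {v})"
    proof (cases "v \<in> A")
      case True
      then have "(A \<times> B \<union> B \<times> A) `` {v} = B" using disj by auto
      then show ?thesis using True g by (simp add: rot_def)
    next
      case False
      then have "(A \<times> B \<union> B \<times> A) `` {v} = A" using ne by auto
      then show ?thesis using False f by (simp add: rot_def)
    qed
  qed
  moreover have "on_quad rot (a, b)" "on_quad rot (b, a)" if ab: "a \<in> A" "b \<in> B" for a b
  proof -
    have neq: "u \<noteq> v" "v \<noteq> u" if "u \<in> A" "v \<in> B" for u v using disj that by auto
    define c where "c = rot b a"
    define d where "d = rot c b"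
    have c: "c \<in> A" "pA c = (\<not> pA a)" using ab f(3) notA[OF ab(2)] by (auto simp: c_def rot_def)
    have d: "d \<in> B" "pB d = (\<not> pB b)" using ab g(3) c by (auto simp: d_def rot_def)
    \<comment> \<open>Since \<open>b\<close> and \<open>d\<close> have opposite parities,
      \<open>rot d\<close> runs round \<open>A\<close> against the direction of \<open>rot b\<close>
      and takes \<open>c\<close> back to \<open>a\<close>. In the same way \<open>rot a\<close>
      undoes \<open>rot c\<close>.\<close>
    have "rot d c = a" using f(3) d ab notA[OF ab(2)] notA[OF d(1)] by (auto simp: c_def rot_def)
    moreover have "rot a d = b" using g(3) c ab by (auto simp: d_def rot_def)
    moreover have "distinct [a, b, c, d]" using c d neq ab by auto
    ultimately show "on_quad rot (a, b)" by (intro on_quadI) (auto simp: c_def d_def)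
    define c where "c = rot a b"
    define d where "d = rot c a"
    have c: "c \<in> B" "pB c = (\<not> pB b)" using ab g(3) by (auto simp: c_def rot_def)
    have d: "d \<in> A" "pA d = (\<not> pA a)" using ab f(3) c notA[OF c(1)] by (auto simp: d_def rot_def)
    have "rot d c = b" using g(3) d ab by (auto simp: c_def rot_def)
    moreover have "rot b d = a" using f(3) c ab notA[OF ab(2)] notA[OF c(1)] by (auto simp: d_def rot_def)
    moreover have "distinct [b, a, c, d]" using c d neq ab by auto
    ultimately show "on_quad rot (b, a)" by (intro on_quadI) (auto simp: c_def d_def)
  qed
  then have "bad_arcs (A \<times> B \<union> B \<times> A) rot = {}" by (auto simp: bad_arcs_def)
  ultimately show ?thesis by blast
qed


section \<open>Complete bipartite subgraphs of dense relations\<close>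

text \<open>Choose a set \<open>S\<close> of constantly many vertices of large out-degree. Double
  counting gives linearly many vertices with at least \<open>t\<close> in-neighbours in
  \<open>S\<close>, and there are only \<open>2 ^ K\<close> possible traces on \<open>S\<close>, so
  \<open>t\<close> of these vertices share a trace. The sets \<open>A\<close> and \<open>B\<close>
  may meet here; irreflexivity separates them later.\<close>

lemma ex_complete_bipartite:
  fixes c :: real and t :: nat
  assumes "c > 0"
  shows "\<exists>N0. \<forall>(V :: 'a set) E. finite V \<longrightarrow> card V \<ge> N0 \<longrightarrow> E \<subseteq> V \<times> V \<longrightarrow>
           real (card E) > c * (real (card V))\<^sup>2 \<longrightarrow>
           (\<exists>A B. card A = t \<and> card B = t \<and> A \<times> B \<subseteq> E)"
proof -
  \<comment> \<open>Chosen so that vertices with fewer than \<open>t\<close> in-neighbours in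
    \<open>S\<close> absorb at most half of the \<open>K * (c / 2 * N)\<close> arcs guaranteed to
    leave \<open>S\<close>.\<close>
  obtain K :: nat where K: "real K \<ge> 4 * (real t + 1) / c" using real_arch_simple by blast
  have K1: "real K * c \<ge> 4 * (real t + 1)" using K assms by (simp add: field_simps)
  have Kpos: "K > 0" using K1 assms by (cases K) auto
  \<comment> \<open>The first term yields \<open>K\<close> vertices of large out-degree, the second
    makes \<open>c / 4 * N\<close> exceed \<open>2 ^ K * t\<close>, and the 1 makes \<open>N\<close>
    positive and the second bound strict.\<close>
  obtain N0 :: nat where N0: "real N0 \<ge> 2 * real K / c + 4 * (2 ^ K * real t) / c + 1"
    using real_arch_simple by blast
  show ?thesis
  proof (intro exI[of _ N0] allI impI)
    fix V :: "'a set" and E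
    assume V: "finite V" "card V \<ge> N0" and E: "E \<subseteq> V \<times> V"
      and dense: "real (card E) > c * (real (card V))\<^sup>2"
    define N where "N = card V"
    have "real N \<ge> real N0" using V by (simp add: N_def)
    moreover have "2 * real K / c \<ge> 0" "4 * (2 ^ K * real t) / c \<ge> 0" using assms by auto
    ultimately have "real N \<ge> 1" "real N \<ge> 2 * real K / c" "real N > 4 * (2 ^ K * real t) / c"
      using N0 by linarith+
    then have N: "real N > 0" "real N * c \<ge> 2 * real K" "real N * c > 4 * (2 ^ K * real t)"
      using assms by (auto simp: field_simps)
    have finE: "finite E" using E V by (meson finite_SigmaI finite_subset)
    define nb where "nb v = {w \<in> V. (v, w) \<in> E}" for v
    have fnb: "finite (nb v)" "card (nb v) \<le> N" for v
      using V by (auto simp: nb_def N_def intro: card_mono)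
    define H where "H = {v \<in> V. real (card (nb v)) \<ge> c / 2 * N}"
    have H: "finite H" "H \<subseteq> V" using V by (auto simp: H_def)
    have "E = Sigma V nb" using E by (auto simp: nb_def)
    then have "real (card E) = (\<Sum>v\<in>V. real (card (nb v)))" using V fnb by simp
    \<comment> \<open>Vertices outside \<open>H\<close> account for at most half of the assumed
      density, and a vertex of \<open>H\<close> for at most \<open>N\<close> arcs, so
      \<open>H\<close> has more than \<open>c / 2 * N\<close> elements.\<close>
    also have "\<dots> \<le> (\<Sum>v\<in>V. (if v \<in> H then real N else 0) + c / 2 * N)"
    proof (rule sum_mono)
      fix v assume "v \<in> V"
      have "0 \<le> c / 2 * N" using assms by simp
      moreover have "real (card (nb v)) \<le> N" using fnb by simp
      ultimately show "real (card (nb v)) \<le> (if v \<in> H then real N else 0) + c / 2 * N"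
        using \<open>v \<in> V\<close> by (auto simp: H_def)
    qed
    also have "\<dots> = card H * real N + N * (c / 2 * N)"
      using V H by (simp add: sum.distrib N_def sum.If_cases Int_absorb1)
    finally have "c * N * N < card H * real N + N * (c / 2 * N)"
      using dense by (simp add: N_def power2_eq_square algebra_simps)
    then have "(c / 2 * N) * N < card H * real N" by (simp add: algebra_simps)
    then have "c / 2 * N < card H" using N by (simp only: mult_less_cancel_right_pos)
    then have "real K \<le> card H" using N by (simp add: algebra_simps)
    then obtain S where S: "S \<subseteq> H" "card S = K" by (meson obtain_subset_with_card_n of_nat_le_iff)
    have finS: "finite S" using S H finite_subset by blast
    define Sw where "Sw w = {v \<in> S. (v, w) \<in> E}" for w
    have cSw: "card (Sw w) \<le> K" for w using finS S by (auto simp: Sw_def intro: card_mono)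
    define W where "W = {w \<in> V. card (Sw w) \<ge> t}"
    have "W \<subseteq> V" by (auto simp: W_def)
    have "real K * (c / 2 * N) = (\<Sum>v\<in>S. c / 2 * N)" using S by simp
    also have "\<dots> \<le> (\<Sum>v\<in>S. real (card (nb v)))"
      using S by (intro sum_mono) (auto simp: H_def)
    also have "\<dots> = real (\<Sum>v\<in>S. card {w \<in> V. (v, w) \<in> E})" by (simp add: nb_def)
    \<comment> \<open>The arcs leaving \<open>S\<close> are now counted by their targets: a target
      in \<open>W\<close> receives at most \<open>K\<close> of them, any other fewer than
      \<open>t\<close>.\<close>
    also have "(\<Sum>v\<in>S. card {w \<in> V. (v, w) \<in> E}) = (\<Sum>w\<in>V. card (Sw w))"
      unfolding Sw_def using V finS sum.swap_restrict[of S V "\<lambda>_ _. 1::nat" "\<lambda>v w. (v, w) \<in> E"]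
      by simp
    also have "real \<dots> \<le> (\<Sum>w\<in>V. (if w \<in> W then real K else 0) + real t)"
      unfolding of_nat_sum
    proof (rule sum_mono)
      fix w assume "w \<in> V"
      then show "real (card (Sw w)) \<le> (if w \<in> W then real K else 0) + real t"
        using cSw[of w] by (auto simp: W_def)
    qed
    also have "\<dots> = card W * real K + N * real t"
      using V \<open>W \<subseteq> V\<close> by (simp add: sum.distrib N_def sum.If_cases Int_absorb1)
    finally have w: "real K * (c / 2 * N) \<le> card W * real K + N * real t" .
    have "N * real t \<le> N * (real K * c / 4)" using K1 N by (intro mult_left_mono) auto
    with w have "(c / 4 * N) * real K \<le> card W * real K" by (simp add: algebra_simps)
    then have "c / 4 * N \<le> card W" using Kpos by (simp only: mult_le_cancel_right_pos of_nat_0_less_iff)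
    then have cW: "real (card W) > 2 ^ K * real t" using N by (simp add: algebra_simps)
    \<comment> \<open>Pigeonhole over the subsets of \<open>S\<close>: if each were the trace of
      fewer than \<open>t\<close> elements of \<open>W\<close>, then \<open>W\<close> would be too
      small.\<close>
    have "\<exists>S'\<in>Pow S. card {w \<in> W. Sw w = S'} \<ge> t"
    proof (rule ccontr)
      assume "\<not> ?thesis"
      then have small: "card {w \<in> W. Sw w = S'} \<le> t" if "S' \<in> Pow S" for S'
        using that nat_le_linear by blast
      have "Sw w \<in> Pow S" for w by (auto simp: Sw_def)
      then have "W = (\<Union>S'\<in>Pow S. {w \<in> W. Sw w = S'})" by blast
      then have "card W \<le> (\<Sum>S'\<in>Pow S. card {w \<in> W. Sw w = S'})"
        using card_UN_le[of "Pow S" "\<lambda>S'. {w \<in> W. Sw w = S'}"] finS by simp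
      also have "\<dots> \<le> (\<Sum>S'\<in>Pow S. t)" by (rule sum_mono) (rule small)
      also have "\<dots> = 2 ^ K * t" using finS S by (simp add: card_Pow)
      finally have "real (card W) \<le> real (2 ^ K * t)" by (simp only: of_nat_le_iff)
      then show False using cW by simp
    qed
    then obtain S' where S': "S' \<subseteq> S" "card {w \<in> W. Sw w = S'} \<ge> t" by blast
    obtain B where B: "B \<subseteq> {w \<in> W. Sw w = S'}" "card B = t"
      by (rule obtain_subset_with_card_n[OF S'(2)])
    show "\<exists>A B. card A = t \<and> card B = t \<and> A \<times> B \<subseteq> E"
    proof (cases "t = 0")
      case True
      then show ?thesis by (intro exI[of _ "{}"]) auto
    next
      case False
      \<comment> \<open>Any element of \<open>B\<close> lies in \<open>W\<close> and has trace
        \<open>S'\<close>, so \<open>S'\<close> itself has at least \<open>t\<close> elements. This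
        needs \<open>B\<close> nonempty, whence the separate case of \<open>t = 0\<close>.\<close>
      then obtain w0 where "w0 \<in> B" using B by (metis card.empty ex_in_conv)
      then have "card S' \<ge> t" using B by (auto simp: W_def)
      then obtain A where A: "A \<subseteq> S'" "card A = t" using obtain_subset_with_card_n by metis
      have "A \<times> B \<subseteq> E" using A B by (auto simp: Sw_def)
      then show ?thesis using A B by blast
    qed
  qed
qed

section \<open>Greedy removal of complete bipartite pieces\<close>

text \<open>Strong induction on the number of arcs. The vertex set stays fixed while arcs are
  removed, so one \<open>N0\<close> and one density threshold serve all stages. The quadratic term
  pays for the sparse remainder, the linear term for the splices.\<close>

lemma dense_near_quadrangular_rotation:
  fixes c :: real and t :: nat
  assumes c: "c > 0" and t: "even t" "t > 0"
  shows "\<exists>N0. \<forall>(V :: 'a set) E. finite V \<longrightarrow> card V \<ge> N0 \<longrightarrow> E \<subseteq> V \<times> V \<longrightarrow> sym E \<longrightarrow> irrefl E \<longrightarrow>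
           (\<exists>rot. rotation_on E rot \<and>
              real (card (bad_arcs E rot)) \<le> c * (real (card V))\<^sup>2 + 8 / real t * real (card E))"
proof -
  obtain N0 where N0: "\<And>(V :: 'a set) E. finite V \<Longrightarrow> card V \<ge> N0 \<Longrightarrow> E \<subseteq> V \<times> V \<Longrightarrow>
      real (card E) > c * (real (card V))\<^sup>2 \<Longrightarrow> \<exists>A B. card A = t \<and> card B = t \<and> A \<times> B \<subseteq> E"
    using ex_complete_bipartite[OF c, of t] by metis
  show ?thesis
  proof (intro exI[of _ N0] allI impI)
    fix V :: "'a set" and E
    assume V: "finite V" "card V \<ge> N0" and "E \<subseteq> V \<times> V" "sym E" "irrefl E"
    then show "\<exists>rot. rotation_on E rot \<and>
        real (card (bad_arcs E rot)) \<le> c * (real (card V))\<^sup>2 + 8 / real t * real (card E)"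
    proof (induction "card E" arbitrary: E rule: less_induct)
      case less
      have finE: "finite E" using less.prems V by (meson finite_SigmaI finite_subset)
      show ?case
      proof (cases "real (card E) > c * (real (card V))\<^sup>2")
        case False
        \<comment> \<open>Below the threshold any rotation will do, even if all arcs are
          bad.\<close>
        obtain rot where "rotation_on E rot" using ex_rotation_on[OF finE] by blast
        moreover have "card (bad_arcs E rot) \<le> card E"
          by (rule card_mono[OF finE]) (auto simp: bad_arcs_def)
        then have "real (card (bad_arcs E rot)) \<le> c * (real (card V))\<^sup>2" using False by linarith
        ultimately show ?thesis by (intro exI[of _ rot]) (auto intro: add_increasing2)
      next
        case True
        then obtain A B where AB: "card A = t" "card B = t" "A \<times> B \<subseteq> E"
          using N0[OF V less.prems(3)] by blast
        have fin: "finite A" "finite B" using AB t by (auto intro: card_ge_0_finite)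
        \<comment> \<open>A common element would give a loop in \<open>A \<times> B\<close>.\<close>
        have disj: "A \<inter> B = {}" using AB(3) \<open>irrefl E\<close> by (auto simp: irrefl_def)
        define E2 where "E2 = A \<times> B \<union> B \<times> A"
        define E1 where "E1 = E - E2"
        have E2: "E2 \<subseteq> E" "sym E2" "finite E2"
          using AB(3) \<open>sym E\<close> fin by (auto simp: E2_def sym_def)
        have "card E2 = card (A \<times> B) + card (B \<times> A)"
          unfolding E2_def using fin disj by (intro card_Un_disjoint) auto
        then have cE2: "card E2 = 2 * t * t" using AB by (simp add: card_cartesian_product)
        have E: "E = E1 \<union> E2" "E1 \<inter> E2 = {}" using E2 by (auto simp: E1_def)
        have E1: "sym E1" "finite E1" "irrefl E1" "E1 \<subseteq> V \<times> V"
          using less.prems E2 finE by (auto simp: E1_def sym_def irrefl_def)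
        have cE: "card E = card E1 + 2 * t * t"
          using card_Un_disjoint[OF E1(2) E2(3) E(2)] E(1) cE2 by simp
        then have "card E1 < card E" using t by simp
        then obtain r1 where r1: "rotation_on E1 r1"
          "real (card (bad_arcs E1 r1)) \<le> c * (real (card V))\<^sup>2 + 8 / real t * real (card E1)"
          using less.hyps[OF _ V E1(4,1,3)] by blast
        obtain r2 where r2: "rotation_on E2 r2" "bad_arcs E2 r2 = {}"
          using complete_bipartite_quadrangulation[OF disj] AB t unfolding E2_def by metis
        have "fst ` E2 \<subseteq> A \<union> B" by (auto simp: E2_def)
        then have "card (fst ` E2) \<le> card (A \<union> B)" using fin by (intro card_mono) auto
        also have "\<dots> \<le> 2 * t" using card_Un_le[of A B] AB by simp
        finally have c2: "card (fst ` E2) \<le> 2 * t" .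
        obtain rot where rot: "rotation_on E rot" "card (bad_arcs E rot) \<le>
            card (bad_arcs E1 r1) + card (bad_arcs E2 r2) + 8 * card (fst ` E2)"
          using merge_rotations[OF r1(1) E1(1,2) r2(1) E2(2,3) E(2)] E(1) by metis
        have "card (bad_arcs E rot) \<le> card (bad_arcs E1 r1) + 16 * t"
          using rot(2) r2(2) c2 by simp
        then have "real (card (bad_arcs E rot)) \<le> real (card (bad_arcs E1 r1)) + 16 * real t"
          by linarith
        also have "\<dots> \<le> c * (real (card V))\<^sup>2 + 8 / real t * real (card E1) + 16 * real t"
          using r1(2) by simp
        \<comment> \<open>The cost \<open>16 * t\<close> of the splices is exactly
          \<open>8 / t\<close> times the \<open>2 * t * t\<close> arcs of the removed piece.\<close>
        also have "\<dots> = c * (real (card V))\<^sup>2 + 8 / real t * real (card E)"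
          using t cE by (simp add: field_simps)
        finally show ?thesis using rot(1) by blast
      qed
    qed
  qed
qed

section \<open>From arcs on quadrangles to edges on quadrangular faces\<close>

lemma on_quad_orbit:
  assumes "distinct [a, b, c, d]" "rot b a = c" "rot c b = d" "rot d c = a" "rot a d = b"
  shows "orbit (face_succ rot) (a, b) = {(a, b), (b, c), (c, d), (d, a)}"
proof
  let ?s = "face_succ rot"
  have s: "?s (a, b) = (b, c)" "?s (b, c) = (c, d)" "?s (c, d) = (d, a)" "?s (d, a) = (a, b)"
    using assms by (auto simp: face_succ_def)
  show "orbit ?s (a, b) \<subseteq> {(a, b), (b, c), (c, d), (d, a)}"
  proof
    fix z assume "z \<in> orbit ?s (a, b)"
    then show "z \<in> {(a, b), (b, c), (c, d), (d, a)}" by induction (use s in auto)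
  qed
  have "(b, c) \<in> orbit ?s (a, b)" using orbit.base[of ?s "(a, b)"] s by simp
  moreover from this have "(c, d) \<in> orbit ?s (a, b)" using orbit.step[of "(b, c)" ?s "(a, b)"] s by simp
  moreover from this have "(d, a) \<in> orbit ?s (a, b)" using orbit.step[of "(c, d)" ?s "(a, b)"] s by simp
  moreover from this have "(a, b) \<in> orbit ?s (a, b)" using orbit.step[of "(d, a)" ?s "(a, b)"] s by simp
  ultimately show "{(a, b), (b, c), (c, d), (d, a)} \<subseteq> orbit ?s (a, b)" by auto
qed

lemma card_quadrangular: "quadrangular F \<Longrightarrow> card F = 4 \<and> finite F"
  by (auto simp: quadrangular_def)

text \<open>The four vertices are distinct, so the walk uses no edge in both directions. This
  separates the faces of \<open>(u, v)\<close> and \<open>(v, u)\<close> when both are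
  quadrangles.\<close>

lemma on_quad_face:
  assumes "on_quad rot (u, v)"
  defines "F \<equiv> orbit (face_succ rot) (u, v)"
  shows "quadrangular F" "(u, v) \<in> F" "(v, u) \<notin> F"
proof -
  obtain c d where q: "distinct [u, v, c, d]" "rot v u = c" "rot c v = d" "rot d c = u" "rot u d = v"
    using assms by (auto simp: on_quad_def)
  have F: "F = {(u, v), (v, c), (c, d), (d, u)}" unfolding F_def by (rule on_quad_orbit[OF q])
  show "quadrangular F" unfolding quadrangular_def using q(1) F by blast
  show "(u, v) \<in> F" "(v, u) \<notin> F" using F q(1) by auto
qed

lemma card_quadrangular_faces_on_edge:
  assumes arcs: "(u, v) \<in> parcs G" "(v, u) \<in> parcs G"
    and q: "on_quad rot (u, v)" "on_quad rot (v, u)"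
  shows "card {F \<in> faces G rot. quadrangular F \<and> on_face {u, v} F} = 2"
proof -
  let ?o = "orbit (face_succ rot)"
  have eq: "F = ?o a" if F: "F \<in> faces G rot" "quadrangular F" and a: "a \<in> F" "quadrangular (?o a)" for F a
  proof -
    obtain x where x: "F = ?o x" using F by (auto simp: faces_def)
    have "?o a \<subseteq> F"
    proof
      fix z assume "z \<in> ?o a"
      then show "z \<in> F" using a(1) unfolding x by (rule orbit_trans)
    qed
    then show ?thesis using card_quadrangular F a by (metis card_subset_eq)
  qed
  have "{F \<in> faces G rot. quadrangular F \<and> on_face {u, v} F} = {?o (u, v), ?o (v, u)}"
  proof (intro equalityI subsetI)
    fix F assume "F \<in> {F \<in> faces G rot. quadrangular F \<and> on_face {u, v} F}"
    then have F: "F \<in> faces G rot" "quadrangular F" "(u, v) \<in> F \<or> (v, u) \<in> F"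
      by (auto simp: on_face_def doubleton_eq_iff)
    then show "F \<in> {?o (u, v), ?o (v, u)}"
      using eq[OF F(1,2)] on_quad_face(1)[OF q(1)] on_quad_face(1)[OF q(2)] by blast
  next
    fix F assume "F \<in> {?o (u, v), ?o (v, u)}"
    then show "F \<in> {F \<in> faces G rot. quadrangular F \<and> on_face {u, v} F}"
      using on_quad_face[OF q(1)] on_quad_face[OF q(2)] arcs
      by (auto simp: faces_def on_face_def)
  qed
  moreover have "?o (u, v) \<noteq> ?o (v, u)" using on_quad_face[OF q(1)] on_quad_face[OF q(2)] by auto
  ultimately show ?thesis by simp
qed

lemma finite_uedges: "finite (parcs G) \<Longrightarrow> finite (uedges G)"
proof -
  have "uedges G = (\<lambda>(u, v). {u, v}) ` parcs G" by (auto simp: uedges_def)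
  then show "finite (parcs G) \<Longrightarrow> finite (uedges G)" by simp
qed

lemma card_parcs_le:
  assumes "finite (parcs G)"
  shows "card (parcs G) \<le> 2 * card (uedges G)"
proof -
  define fib where "fib e = {a :: 'a \<times> 'a. {fst a, snd a} = e}" for e
  have sub: "parcs G \<subseteq> \<Union> (fib ` uedges G)" by (force simp: uedges_def fib_def)
  have two: "finite (fib e)" "card (fib e) \<le> 2" if e: "e \<in> uedges G" for e
  proof -
    obtain x y where "e = {x, y}" using e by (auto simp: uedges_def)
    then have sub: "fib e \<subseteq> {(x, y), (y, x)}" by (auto simp: fib_def doubleton_eq_iff)
    show "finite (fib e)" by (rule finite_subset[OF sub]) simp
    have "card (fib e) \<le> card {(x, y), (y, x)}" by (rule card_mono[OF _ sub]) simp
    also have "\<dots> \<le> 2" using card_insert_le_m1[of 2 "{(y, x)}" "(x, y)"] by simp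
    finally show "card (fib e) \<le> 2" .
  qed
  have "card (parcs G) \<le> card (\<Union> (fib ` uedges G))"
    by (rule card_mono[OF _ sub]) (simp add: finite_uedges[OF assms] two(1))
  also have "\<dots> \<le> (\<Sum>e\<in>uedges G. card (fib e))"
    by (rule card_UN_le[OF finite_uedges[OF assms]])
  also have "\<dots> \<le> (\<Sum>e\<in>uedges G. 2)" by (rule sum_mono) (rule two(2))
  finally show ?thesis by simp
qed

text \<open>An edge with both orientations on quadrangles lies on two quadrangular faces. So every
  exceptional edge has a bad orientation, and there are at most as many such edges as bad
  arcs.\<close>

lemma near_quadrangularI:
  assumes "finite (parcs G)" "sym (parcs G)"
    and "real (card (bad_arcs (parcs G) rot)) \<le> 2 * \<delta> * real (card (uedges G))"
  shows "near_quadrangular \<delta> G rot"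
proof -
  let ?bad = "{e \<in> uedges G. card {F \<in> faces G rot. quadrangular F \<and> on_face e F} \<noteq> 2}"
  have sub: "?bad \<subseteq> (\<lambda>(u, v). {u, v}) ` bad_arcs (parcs G) rot"
  proof
    fix e assume e: "e \<in> ?bad"
    then obtain u v where uv: "e = {u, v}" "(u, v) \<in> parcs G" by (auto simp: uedges_def)
    have vu: "(v, u) \<in> parcs G" using uv assms(2) by (auto dest: symD)
    have "(u, v) \<in> bad_arcs (parcs G) rot \<or> (v, u) \<in> bad_arcs (parcs G) rot"
      using card_quadrangular_faces_on_edge[OF uv(2) vu, of rot] e uv vu by (auto simp: bad_arcs_def)
    then show "e \<in> (\<lambda>(u, v). {u, v}) ` bad_arcs (parcs G) rot"
      using uv(1) by (force simp: insert_commute)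
  qed
  have "finite (bad_arcs (parcs G) rot)" using assms(1) by (simp add: bad_arcs_def)
  then have "card ?bad \<le> card (bad_arcs (parcs G) rot)" using sub by (rule surj_card_le)
  then show ?thesis using assms(3) unfolding near_quadrangular_def by linarith
qed

section \<open>Edge density from the cut distance, and the choice of constants\<close>

text \<open>The cut distance is tested on the single pair \<open>V1\<close>, \<open>V2\<close>;
  edges of \<open>G\<close> inside either class only increase the count.\<close>

lemma card_uedges_quasirandom:
  assumes fin: "finite (parcs G)" and V: "V1 \<inter> V2 = {}" "V1 \<union> V2 = pverts G" "card V1 = n" "card V2 = n"
    and n: "n > 0"
    and dist: "cut_dist (pverts G) (graph_weight G) (complete_bipartite_weight V1 V2 p) < \<epsilon>"
  shows "real (card (uedges G)) \<ge> (p - 4 * \<epsilon>) * (real n)\<^sup>2"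
proof -
  let ?w = "graph_weight G" and ?k = "complete_bipartite_weight V1 V2 p"
  let ?D = "{\<bar>cut_weight ?w U W - cut_weight ?k U W\<bar> | U W. U \<subseteq> pverts G \<and> W \<subseteq> pverts G}"
  let ?C = "{{u, v} | u v. u \<in> V1 \<and> v \<in> V2 \<and> u \<noteq> v}"
  have finV: "finite V1" "finite V2" using V n by (auto intro: card_ge_0_finite)
  then have "finite (pverts G)" using V by (metis finite_Un)
  have "?D = (\<lambda>(U, W). \<bar>cut_weight ?w U W - cut_weight ?k U W\<bar>) ` (Pow (pverts G) \<times> Pow (pverts G))"
    by auto
  then have "finite ?D" using \<open>finite (pverts G)\<close> by simp
  moreover have "\<bar>cut_weight ?w V1 V2 - cut_weight ?k V1 V2\<bar> \<in> ?D" using V by blast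
  ultimately have "\<bar>cut_weight ?w V1 V2 - cut_weight ?k V1 V2\<bar> \<le> Max ?D" by (rule Max_ge)
  \<comment> \<open>The cut distance is normalised by the square of \<open>2 * n\<close>, which is
    the source of the factor 4 before \<open>\<epsilon>\<close>.\<close>
  also have "card (pverts G) = 2 * n" using V finV card_Un_disjoint by fastforce
  then have "Max ?D < \<epsilon> * (2 * real n)\<^sup>2"
    using dist n unfolding cut_dist_def by (simp add: field_simps)
  finally have "cut_weight ?k V1 V2 - 4 * \<epsilon> * (real n)\<^sup>2 < cut_weight ?w V1 V2"
    by (simp add: power2_eq_square)
  moreover have C: "?C = (\<lambda>(u, v). {u, v}) ` (V1 \<times> V2)" using V(1) by (fastforce simp: image_def)
  then have "finite ?C" using finV by simp
  \<comment> \<open>Disjointness of the classes makes unordered edges correspond to ordered pairs,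
    so the complete bipartite weight is \<open>p\<close> times \<open>n * n\<close>.\<close>
  have "inj_on (\<lambda>(u, v). {u, v}) (V1 \<times> V2)" using V(1) by (auto simp: inj_on_def doubleton_eq_iff)
  then have "card ?C = n * n" unfolding C using V by (simp add: card_image card_cartesian_product)
  moreover have "cut_weight ?k V1 V2 = (\<Sum>e\<in>?C. p)"
    unfolding cut_weight_def by (rule sum.cong) (auto simp: complete_bipartite_weight_def)
  ultimately have "p * (real n)\<^sup>2 - 4 * \<epsilon> * (real n)\<^sup>2 < cut_weight ?w V1 V2"
    by (simp add: power2_eq_square algebra_simps)
  also have "cut_weight ?w V1 V2 = real (card (?C \<inter> uedges G))"
    unfolding cut_weight_def graph_weight_def using \<open>finite ?C\<close> by (simp add: sum.If_cases)
  also have "\<dots> \<le> real (card (uedges G))"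
    using finite_uedges[OF fin] by (simp add: card_mono)
  finally show ?thesis by (simp add: algebra_simps)
qed

theorem theorem3p9:
  fixes p \<epsilon> :: real
  assumes "0 < p" and "p \<le> 1" and "0 < \<epsilon>" and "\<epsilon> < (p / 4) ^ 16"
  shows "\<exists>n0::nat. \<forall>n\<ge>n0. \<forall>G \<in> (quasirandom_bipartite n p \<epsilon> :: 'a pair_pre_digraph set).
           \<exists>rot. rotation_system G rot \<and> near_quadrangular (10 * \<epsilon>) G rot"
proof -
  have "(p / 4) ^ 16 \<le> (p / 4) ^ 1" using assms by (intro power_decreasing) auto
  then have gap: "p - 4 * \<epsilon> > 0" using assms by simp
  \<comment> \<open>The budget is \<open>20 * \<epsilon>\<close> times the number of edges. With
    \<open>2 * n\<close> vertices the quadratic term becomes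
    \<open>10 * \<epsilon> * (p - 4 * \<epsilon>) * n * n\<close>, at most half of it by the edge
    bound.\<close>
  define c where "c = 10 * \<epsilon> * (p - 4 * \<epsilon>) / 4"
  have c: "c > 0" using gap assms by (simp add: c_def)
  \<comment> \<open>An even \<open>t\<close> of size at least \<open>2 / \<epsilon>\<close> gives
    \<open>8 / t\<close> at most \<open>5 * \<epsilon>\<close>. As there are at most two arcs per
    edge, the linear term stays within the other half of the budget.\<close>
  obtain m :: nat where m: "real m \<ge> 1 / \<epsilon>" using real_arch_simple by blast
  define t where "t = 2 * (m + 1)"
  have t: "even t" "t > 0" by (auto simp: t_def)
  have "1 / \<epsilon> \<le> real t" using m by (simp add: t_def)
  then have t\<epsilon>: "8 / real t \<le> 5 * \<epsilon>"
    using m t assms by (simp add: t_def field_simps)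
  obtain N0 where N0: "\<And>(V :: 'a set) E. finite V \<Longrightarrow> card V \<ge> N0 \<Longrightarrow> E \<subseteq> V \<times> V \<Longrightarrow>
      sym E \<Longrightarrow> irrefl E \<Longrightarrow> \<exists>rot. rotation_on E rot \<and>
        real (card (bad_arcs E rot)) \<le> c * (real (card V))\<^sup>2 + 8 / real t * real (card E)"
    using dense_near_quadrangular_rotation[OF c t] by metis
  show ?thesis
  \<comment> \<open>The extra 1 makes \<open>n\<close> positive, as the edge bound requires.\<close>
  proof (intro exI[of _ "N0 + 1"] allI impI ballI)
    fix n and G :: "'a pair_pre_digraph"
    assume n: "n \<ge> N0 + 1" and "G \<in> quasirandom_bipartite n p \<epsilon>"
    then obtain V1 V2 where G: "pair_graph G"
      and V: "V1 \<inter> V2 = {}" "V1 \<union> V2 = pverts G" "card V1 = n" "card V2 = n"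
        "cut_dist (pverts G) (graph_weight G) (complete_bipartite_weight V1 V2 p) < \<epsilon>"
      by (auto simp: quasirandom_bipartite_def)
    interpret pair_graph G by (rule G)
    have E: "parcs G \<subseteq> pverts G \<times> pverts G" using in_arcsD1 in_arcsD2 by auto
    have fin: "finite (pverts G)" "finite (parcs G)" by auto
    have sym: "sym (parcs G)" using arcs_symmetric by (auto simp: sym_def)
    have irr: "irrefl (parcs G)" using no_loops' by (auto simp: irrefl_def)
    have "finite V1" "finite V2" using V fin by (metis finite_Un)+
    then have cV: "card (pverts G) = 2 * n" using V card_Un_disjoint by fastforce
    then have "card (pverts G) \<ge> N0" using n by simp
    then obtain rot where rot: "rotation_on (parcs G) rot"
      "real (card (bad_arcs (parcs G) rot)) \<le>
         c * (real (card (pverts G)))\<^sup>2 + 8 / real t * real (card (parcs G))"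
      using N0[OF fin(1) _ E sym irr] by blast
    have "c * (real (card (pverts G)))\<^sup>2 = 10 * \<epsilon> * ((p - 4 * \<epsilon>) * (real n)\<^sup>2)"
      by (simp add: cV c_def power2_eq_square)
    also have "\<dots> \<le> 10 * \<epsilon> * real (card (uedges G))"
      using card_uedges_quasirandom[OF fin(2) V(1-4) _ V(5)] n assms by (intro mult_left_mono) auto
    finally have 1: "c * (real (card (pverts G)))\<^sup>2 \<le> 10 * \<epsilon> * real (card (uedges G))" .
    have "real (card (parcs G)) \<le> 2 * real (card (uedges G))"
      using card_parcs_le[OF fin(2)] by linarith
    then have "8 / real t * real (card (parcs G)) \<le> 5 * \<epsilon> * (2 * real (card (uedges G)))"
      using t\<epsilon> assms by (intro mult_mono) auto
    then have "real (card (bad_arcs (parcs G) rot)) \<le> 2 * (10 * \<epsilon>) * real (card (uedges G))"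
      using rot(2) 1 by linarith
    then have "near_quadrangular (10 * \<epsilon>) G rot" by (rule near_quadrangularI[OF fin(2) sym])
    moreover have "rotation_system G rot"
      using rot(1) by (auto simp: rotation_system_def rotation_on_def neighbours_def Image_singleton)
    ultimately show "\<exists>rot. rotation_system G rot \<and> near_quadrangular (10 * \<epsilon>) G rot" by blast
  qed
qed

end
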